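(* Consider the Gaussian sequence model $X_i=\theta_i+\frac1{\sqrt n}\varepsilon_i$, $i=1,\dots,m$, with independent $\varepsilon_i\sim\mathcal N(0,1)$ and parameter space $\Theta_m^\beta(R)=\{\theta\in\mathbb R^m:\|\theta\|_2\le R/(\Gamma_\beta m^\beta)\}$. For any estimator $\widehat\theta$ there exists a spherically symmetric estimator $\widetilde\theta$ such that $$\sup_{\theta\in\Theta_m^\beta(R)}\big\|E_\theta[\widetilde\theta]-\theta\big\|_2^2\le\sup_{\theta\in\Theta_m^\beta(R)}\big\|E_\theta[\widehat\theta]-\theta\big\|_2^2\quad\text{and}\quad\sup_{\theta\in\Theta_m^\beta(R)}\sum_{i=1}^m\mathrm{Var}_\theta(\widetilde\theta_i)\le\sup_{\theta\in\Theta_m^\beta(R)}\sum_{i=1}^m\mathrm{Var}_\theta(\widehat\theta_i).$$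
   Context: $m,\beta$ are positive integers, $R>0$, $\|\cdot\|_2$ is the Euclidean norm. An estimator is a measurable function $\widehat\theta=\widehat\theta(X)\in\mathbb R^m$ of $X=(X_1,\dots,X_m)^\top$ such that $E_\theta[\widehat\theta]$ exists and is finite for all $\theta$ in the parameter space. A function $g:\mathbb R^m\to\mathbb R^m$ is spherically symmetric if $g(x)=D^{-1}g(Dx)$ for every $x\in\mathbb R^m$ and every orthogonal $m\times m$ matrix $D$; an estimator $\widetilde\theta=\widetilde\theta(X)$ is spherically symmetric if $X\mapsto\widetilde\theta(X)$ is spherically symmetric. $\Gamma_\beta:=\inf\{\|K\|_{S^\beta(\mathbb R)}:\|K\|_{L^2(\mathbb R)}=1,\ \mathrm{supp}\,K\subset[-1/2,1/2]\}$, where $\|K\|_{S^\beta(\mathbb R)}^2=\|K\|_{L^2(\mathbb R)}^2+\|K^{(\beta)}\|_{L^2(\mathbb R)}^2$. *)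

theory Defs
  imports "HOL-Probability.Probability"
begin

definition supp :: "(real \<Rightarrow> real) \<Rightarrow> real set" where
  "supp f = closure {x. f x \<noteq> 0}"

definition L2 :: "(real \<Rightarrow> real) \<Rightarrow> bool" where
  "L2 f \<longleftrightarrow> f \<in> borel_measurable lborel \<and> integrable lborel (\<lambda>x. (f x)\<^sup>2)"

definition L2_norm :: "(real \<Rightarrow> real) \<Rightarrow> real" where
  "L2_norm f = sqrt (\<integral>x. (f x)\<^sup>2 \<partial>lborel)"

definition test_function :: "(real \<Rightarrow> real) \<Rightarrow> bool" where
  "test_function \<phi> \<longleftrightarrow>
     (\<forall>k x. ((deriv ^^ k) \<phi>) field_differentiable (at x)) \<and> compact (supp \<phi>)"

definition has_weak_deriv :: "nat \<Rightarrow> (real \<Rightarrow> real) \<Rightarrow> (real \<Rightarrow> real) \<Rightarrow> bool" where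
  "has_weak_deriv b f g \<longleftrightarrow> (\<forall>\<phi>. test_function \<phi> \<longrightarrow>
     (\<integral>x. f x * (deriv ^^ b) \<phi> x \<partial>lborel) = (-1) ^ b * (\<integral>x. g x * \<phi> x \<partial>lborel))"

definition sobolev :: "nat \<Rightarrow> (real \<Rightarrow> real) \<Rightarrow> bool" where
  "sobolev b f \<longleftrightarrow> L2 f \<and> (\<exists>g. L2 g \<and> has_weak_deriv b f g)"

text \<open>Meaningful only if \<^term>\<open>sobolev b f\<close>; the choice is then unique almost everywhere.\<close>

definition weak_deriv :: "nat \<Rightarrow> (real \<Rightarrow> real) \<Rightarrow> real \<Rightarrow> real" where
  "weak_deriv b f = (SOME g. L2 g \<and> has_weak_deriv b f g)"

definition sobolev_norm :: "nat \<Rightarrow> (real \<Rightarrow> real) \<Rightarrow> real" where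
  "sobolev_norm b f = sqrt ((L2_norm f)\<^sup>2 + (L2_norm (weak_deriv b f))\<^sup>2)"

text \<open>The functions \<open>K\<close> range over Borel representatives; since every \<open>L\<^sup>2\<close> class that vanishes
  almost everywhere off \<open>[-1/2, 1/2]\<close> has a representative vanishing everywhere off it,
  the pointwise support yields the same infimum as the essential support.\<close>

definition Gamma_const :: "nat \<Rightarrow> real" where
  "Gamma_const b =
     Inf {sobolev_norm b K |K. sobolev b K \<and> L2_norm K = 1 \<and> supp K \<subseteq> {-1/2..1/2}}"

definition Theta :: "nat \<Rightarrow> real \<Rightarrow> (real ^ 'm) set" where
  "Theta b R = {\<theta>. norm \<theta> \<le> R / (Gamma_const b * real CARD('m) ^ b)}"

definition observation ::
    "real \<Rightarrow> ('m \<Rightarrow> 'w \<Rightarrow> real) \<Rightarrow> real ^ 'm \<Rightarrow> 'w \<Rightarrow> real ^ 'm" where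
  "observation n \<epsilon> \<theta> \<omega> = (\<chi> i. \<theta> $ i + 1 / sqrt n * \<epsilon> i \<omega>)"

definition standard_normal_noise :: "'w measure \<Rightarrow> ('m \<Rightarrow> 'w \<Rightarrow> real) \<Rightarrow> bool" where
  "standard_normal_noise M \<epsilon> \<longleftrightarrow> prob_space M \<and>
     prob_space.indep_vars M (\<lambda>_. borel) \<epsilon> UNIV \<and>
     (\<forall>i. distributed M lborel (\<epsilon> i) std_normal_density)"

definition estimator ::
    "'w measure \<Rightarrow> ('m \<Rightarrow> 'w \<Rightarrow> real) \<Rightarrow> real \<Rightarrow> (real ^ 'm) set \<Rightarrow> (real ^ 'm \<Rightarrow> real ^ 'm) \<Rightarrow> bool" where
  "estimator M \<epsilon> n \<Theta> T \<longleftrightarrow> T \<in> borel_measurable borel \<and>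
     (\<forall>\<theta>\<in>\<Theta>. integrable M (\<lambda>\<omega>. T (observation n \<epsilon> \<theta> \<omega>)))"

definition spherically_symmetric :: "(real ^ 'm \<Rightarrow> real ^ 'm) \<Rightarrow> bool" where
  "spherically_symmetric g \<longleftrightarrow>
     (\<forall>x. \<forall>D :: real ^ 'm ^ 'm. orthogonal_matrix D \<longrightarrow> g x = matrix_inv D *v g (D *v x))"

definition mean ::
    "'w measure \<Rightarrow> ('m \<Rightarrow> 'w \<Rightarrow> real) \<Rightarrow> real \<Rightarrow> real ^ 'm \<Rightarrow> (real ^ 'm \<Rightarrow> real ^ 'm) \<Rightarrow> real ^ 'm" where
  "mean M \<epsilon> n \<theta> T = (\<integral>\<omega>. T (observation n \<epsilon> \<theta> \<omega>) \<partial>M)"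

text \<open>Estimators need not have second moments, so the variance takes values in \<open>[0, \<infinity>]\<close>.\<close>

definition Var ::
    "'w measure \<Rightarrow> ('m \<Rightarrow> 'w \<Rightarrow> real) \<Rightarrow> real \<Rightarrow> real ^ 'm \<Rightarrow> (real ^ 'm \<Rightarrow> real ^ 'm) \<Rightarrow> 'm \<Rightarrow> ennreal" where
  "Var M \<epsilon> n \<theta> T i =
     (\<integral>\<^sup>+\<omega>. ennreal ((T (observation n \<epsilon> \<theta> \<omega>) $ i - mean M \<epsilon> n \<theta> T $ i)\<^sup>2) \<partial>M)"

end

theory Submission
  imports Defs
begin

text \<open>
  Averaging over the orthogonal group with its Haar measure \<open>\<mu>\<close>, put
  \<open>S(x) = \<integral> D\<^sup>T T(D x) d\<mu>(D)\<close>. Since the noise is rotation invariant, \<open>D X\<close> has under \<open>\<theta>\<close> the law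
  that \<open>X\<close> has under \<open>D \<theta>\<close>, so bias and centred error of \<open>S\<close> at \<open>\<theta>\<close> are averages of rotated biases and
  centred errors of \<open>T\<close> at the points \<open>D \<theta>\<close> of the same ball; convexity of the norm and of its square
  gives both bounds.

  Integrability of \<open>T\<close> at every \<open>\<theta>\<close> does not make \<open>T(D X)\<close> integrable jointly in \<open>D\<close> and \<open>X\<close>. It is
  so when both suprema of \<open>T\<close> are finite. If the supremum of the bias is infinite, the zero
  estimator will do, and if that of the variance is infinite, the identity will do.

  The Haar measure is the law of the Gram--Schmidt orthonormalisation of the rows of a random
  invertible matrix uniformly distributed in a ball.
\<close>

section \<open>Rotation invariance of Lebesgue measure\<close>

lemma nn_integral_lborel_translate:
  fixes a :: "'a::euclidean_space"
  assumes [measurable]: "h \<in> borel_measurable borel"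
  shows "(\<integral>\<^sup>+x. h (a + x) \<partial>lborel) = (\<integral>\<^sup>+x. h x \<partial>lborel)"
proof -
  have "(\<integral>\<^sup>+x. h x \<partial>lborel) = (\<integral>\<^sup>+x. h x \<partial>distr lborel borel ((+) a))"
    by (simp add: lborel_distr_plus)
  also have "\<dots> = (\<integral>\<^sup>+x. h (a + x) \<partial>lborel)"
    by (rule nn_integral_distr) auto
  finally show ?thesis ..
qed

lemma emeasure_lborel_open_bounded:
  fixes G :: "'a::euclidean_space set"
  assumes "open G" "bounded G" "G \<noteq> {}"
  shows "emeasure lborel G \<noteq> 0" "emeasure lborel G \<noteq> \<infinity>"
proof -
  have "G \<notin> null_sets lborel"
    using assms open_not_negligible[of G] null_sets_completionI[of G lborel]
    by (auto simp: negligible_iff_null_sets)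
  then show "emeasure lborel G \<noteq> 0" using \<open>open G\<close> by auto
  show "emeasure lborel G \<noteq> \<infinity>"
    using emeasure_bounded_finite[OF \<open>bounded G\<close>] by auto
qed

text \<open>Both measures are translation invariant. Fubini's theorem, applied to the product of the indicators
  of \<open>A\<close> and of the unit ball, shows that they are proportional, and they agree on the ball.\<close>

lemma lborel_distr_orthogonal_transformation:
  fixes f :: "'a::euclidean_space \<Rightarrow> 'a"
  assumes f: "orthogonal_transformation f"
  shows "distr lborel borel f = lborel"
proof (rule measure_eqI)
  fix A assume "A \<in> sets (distr lborel borel f)"
  then have [measurable]: "A \<in> sets borel" by simp
  have lin: "linear f" and nf: "\<And>x. norm (f x) = norm x"
    using f by (auto simp: orthogonal_transformation)
  have [measurable]: "f \<in> borel_measurable borel"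
    by (intro borel_measurable_continuous_onI linear_continuous_on linear_conv_bounded_linear[THEN iffD1] lin)
  define B where "B = ball (0::'a) 1"
  have [measurable]: "B \<in> sets borel" by (simp add: B_def)
  obtain g where g: "\<And>x. f (g x) = x"
    using orthogonal_transformation_surj[OF f] by (metis surjD)
  have sym: "indicator B (- x) = (indicator B x :: ennreal)" for x
    by (simp add: B_def indicator_def)
  have Bf: "indicator B (f x) = (indicator B x :: ennreal)" for x
    by (simp add: B_def indicator_def nf)
  have "emeasure lborel A * emeasure lborel B
      = (\<integral>\<^sup>+y. \<integral>\<^sup>+x. indicator A x * indicator B (f y) \<partial>lborel \<partial>lborel)"
    by (simp add: nn_integral_multc nn_integral_cmult Bf)
  also have "\<dots> = (\<integral>\<^sup>+y. \<integral>\<^sup>+x. indicator A (f y + x) * indicator B (f y) \<partial>lborel \<partial>lborel)"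
    by (intro nn_integral_cong nn_integral_lborel_translate[symmetric]) measurable
  also have "\<dots> = (\<integral>\<^sup>+x. \<integral>\<^sup>+y. indicator A (f y + x) * indicator B (f y) \<partial>lborel \<partial>lborel)"
    by (rule lborel_pair.Fubini') measurable
  \<comment> \<open>Since \<open>f (g x) = x\<close>, shifting \<open>y\<close> by
    \<open>- g x\<close> turns \<open>f y + x\<close> into \<open>f y\<close> and moves
    \<open>x\<close> into the indicator of the ball.\<close>
  also have "\<dots> = (\<integral>\<^sup>+x. \<integral>\<^sup>+y. indicator A (f (- g x + y) + x) * indicator B (f (- g x + y)) \<partial>lborel \<partial>lborel)"
    by (intro nn_integral_cong nn_integral_lborel_translate[symmetric]) measurable
  also have "\<dots> = (\<integral>\<^sup>+x. \<integral>\<^sup>+y. indicator A (f y) * indicator B (f y - x) \<partial>lborel \<partial>lborel)"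
    by (simp add: linear_add[OF lin] linear_neg[OF lin] linear_diff[OF lin] g)
  also have "\<dots> = (\<integral>\<^sup>+y. \<integral>\<^sup>+x. indicator A (f y) * indicator B (f y - x) \<partial>lborel \<partial>lborel)"
    by (rule lborel_pair.Fubini') measurable
  also have "\<dots> = (\<integral>\<^sup>+y. indicator A (f y) * emeasure lborel B \<partial>lborel)"
  proof (rule nn_integral_cong)
    fix y
    \<comment> \<open>Translating by \<open>f y\<close> leaves the indicator of \<open>B\<close> at
      \<open>- x\<close>, and the ball is symmetric.\<close>
    have "(\<integral>\<^sup>+x. indicator B (f y - x) \<partial>lborel) = (\<integral>\<^sup>+x. indicator B (f y - (f y + x)) \<partial>lborel)"
      by (rule nn_integral_lborel_translate[symmetric]) measurable
    then show "(\<integral>\<^sup>+x. indicator A (f y) * indicator B (f y - x) \<partial>lborel)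
        = indicator A (f y) * emeasure lborel B"
      by (simp add: nn_integral_cmult sym)
  qed
  also have "\<dots> = (\<integral>\<^sup>+y. indicator A (f y) \<partial>lborel) * emeasure lborel B"
    by (rule nn_integral_multc) measurable
  also have "(\<integral>\<^sup>+y. indicator A (f y) \<partial>lborel) = emeasure (distr lborel borel f) A"
    using measurable_sets_borel[of f borel A]
    by (simp add: emeasure_distr indicator_vimage[unfolded comp_def, symmetric])
  finally have "emeasure lborel A * emeasure lborel B
      = emeasure (distr lborel borel f) A * emeasure lborel B" .
  moreover have "emeasure lborel B \<noteq> 0" "emeasure lborel B \<noteq> \<infinity>"
    using emeasure_lborel_open_bounded[of B] by (auto simp: B_def)
  ultimately show "emeasure (distr lborel borel f) A = emeasure lborel A"
    by (simp add: ennreal_mult_cancel_left mult.commute[of _ "emeasure lborel B"])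
qed simp

section \<open>An invariant probability measure on the orthogonal group\<close>

text \<open>The list imposes an order on the index type; its head is treated last.
  \<open>sgn\<close> normalises, and \<open>sgn 0 = 0\<close> keeps the map defined, and Borel
  measurable, on singular matrices too.\<close>

fun gram_schmidt :: "'m list \<Rightarrow> real ^ 'n ^ 'm \<Rightarrow> 'm \<Rightarrow> real ^ 'n" where
  "gram_schmidt [] A = (\<lambda>_. 0)"
| "gram_schmidt (k # ks) A = (gram_schmidt ks A)
     (k := sgn (A $ k - (\<Sum>j\<in>set ks. (A $ k \<bullet> gram_schmidt ks A j) *\<^sub>R gram_schmidt ks A j)))"

lemma gram_schmidt_measurable:
  fixes ks :: "'m::finite list"
  shows "(\<lambda>A :: real ^ 'n ^ 'm. gram_schmidt ks A i) \<in> borel_measurable borel"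
proof (induction ks arbitrary: i)
  case (Cons k ks)
  note [measurable] = Cons.IH borel_measurable_sgn[THEN measurable_compose[rotated]]
  have [measurable]: "(\<lambda>A :: real ^ 'n ^ 'm. A $ k) \<in> borel_measurable borel"
    by (intro borel_measurable_continuous_onI continuous_intros)
  show ?case by (cases "i = k") auto
qed simp

text \<open>Inner products, linear combinations and normalisation all commute with a linear
  isometry. This equivariance carries invariance from random matrices to their orthonormalised
  rows.\<close>

lemma gram_schmidt_orthogonal_transformation:
  assumes "orthogonal_transformation f"
  shows "gram_schmidt ks (\<chi> i. f (A $ i)) i = f (gram_schmidt ks A i)"
proof (induction ks arbitrary: i)
  case (Cons k ks)
  have lin: "linear f" and inner: "\<And>x y. f x \<bullet> f y = x \<bullet> y" and norm: "\<And>x. norm (f x) = norm x"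
    using assms by (auto simp: orthogonal_transformation_def orthogonal_transformation_norm)
  have "f (sgn x) = sgn (f x)" for x
    by (simp add: sgn_div_norm norm linear_cmul[OF lin])
  then show ?case
    by (simp add: Cons.IH inner linear_diff[OF lin] linear_sum[OF lin] linear_cmul[OF lin])
qed (use assms in \<open>simp add: orthogonal_transformation_def linear_0\<close>)

lemma gram_schmidt_span:
  "i \<in> set ks \<Longrightarrow> gram_schmidt ks A i \<in> span {A $ j |j. j \<in> set ks}"
proof (induction ks arbitrary: i)
  case (Cons k ks)
  let ?V = "span {A $ j |j. j \<in> set (k # ks)}"
  have sub: "gram_schmidt ks A j \<in> ?V" if "j \<in> set ks" for j
    using Cons.IH[OF that] span_mono[of "{A $ j |j. j \<in> set ks}" "{A $ j |j. j \<in> set (k # ks)}"] by auto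
  have "A $ k \<in> ?V"
    by (rule span_base) auto
  with Cons.prems sub show ?case
    by (auto simp: sgn_div_norm intro!: span_scale span_diff span_sum)
qed simp

lemma orthonormal_gram_schmidt:
  fixes A :: "real ^ 'm ^ 'm"
  assumes "det A \<noteq> 0" "distinct ks" "i \<in> set ks" "j \<in> set ks"
  shows "gram_schmidt ks A i \<bullet> gram_schmidt ks A j = (if i = j then 1 else 0)"
  using assms(2-)
proof (induction ks arbitrary: i j)
  case (Cons k ks)
  define q where "q = gram_schmidt ks A"
  define v where "v = A $ k - (\<Sum>j\<in>set ks. (A $ k \<bullet> q j) *\<^sub>R q j)"
  have k: "k \<notin> set ks" using Cons.prems by simp
  have q: "q i \<bullet> q j = (if i = j then 1 else 0)" if "i \<in> set ks" "j \<in> set ks" for i j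
    using Cons that by (simp add: q_def)
  have "v \<noteq> 0"
  proof
    assume "v = 0"
    moreover have "(\<Sum>j\<in>set ks. (A $ k \<bullet> q j) *\<^sub>R q j) \<in> span {A $ j |j. j \<in> set ks}"
      by (intro span_sum span_scale) (auto simp: q_def gram_schmidt_span)
    ultimately have "A $ k \<in> span {A $ j |j. j \<in> set ks}"
      by (simp add: v_def)
    \<comment> \<open>Adding to row \<open>k\<close> a combination of the other rows preserves the
      determinant, yet adding \<open>- row k A\<close> makes that row zero.\<close>
    then have "- row k A \<in> span {row j A |j. j \<noteq> k}"
      using k span_mono[of "{A $ j |j. j \<in> set ks}" "{A $ j |j. j \<noteq> k}"]
      by (auto simp: row_def intro!: span_neg)
    then have "det (\<chi> j. if j = k then row k A + - row k A else row j A) = det A"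
      by (intro det_row_span) (simp add: span_vec_eq)
    moreover have "det (\<chi> j. if j = k then row k A + - row k A else row j A) = 0"
      by (rule det_zero_row(2)[of k]) (simp add: row_def vec_eq_iff)
    ultimately show False using assms(1) by simp
  qed
  then have vv: "sgn v \<bullet> sgn v = 1"
    by (simp add: dot_square_norm norm_sgn)
  have vq: "v \<bullet> q j = 0" if j: "j \<in> set ks" for j
  proof -
    have "(\<Sum>i\<in>set ks. (A $ k \<bullet> q i) * (q i \<bullet> q j)) = (\<Sum>i\<in>set ks. if i = j then A $ k \<bullet> q i else 0)"
      by (intro sum.cong) (auto simp: q j)
    also have "\<dots> = A $ k \<bullet> q j" using j by simp
    finally show ?thesis by (simp add: v_def inner_diff_left inner_sum_left)
  qed
  have gs: "gram_schmidt (k # ks) A = q(k := sgn v)"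
    by (simp add: q_def v_def)
  have "sgn v \<bullet> q j = 0" "q j \<bullet> sgn v = 0" if "j \<in> set ks" for j
    using vq[OF that] by (simp_all add: sgn_div_norm inner_commute)
  with k Cons.prems show ?case
    unfolding gs by (auto simp: vv q)
qed simp

section \<open>Right multiplication by orthogonal matrices\<close>

lemma norm_orthogonal_matrix:
  fixes Q :: "real ^ 'n ^ 'n"
  shows "orthogonal_matrix Q \<Longrightarrow> norm (Q *v x) = norm x"
  using orthogonal_transformation_matrix[of "(*v) Q"]
  by (simp add: orthogonal_transformation)

lemma linear_matrix_mult_right: "linear (\<lambda>A. A ** (Q :: real ^ 'k ^ 'n))"
  by (intro linearI)
    (simp_all add: matrix_matrix_mult_def vec_eq_iff distrib_right sum.distrib scaleR_right.sum sum_distrib_left mult.assoc)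

lemma matrix_matrix_mult_measurable [measurable]:
  "(\<lambda>A. A ** (Q :: real ^ 'k ^ 'n)) \<in> borel_measurable borel"
  by (intro borel_measurable_continuous_onI linear_continuous_on linear_conv_bounded_linear[THEN iffD1])
    (rule linear_matrix_mult_right)

text \<open>Acting on each row separately by \<open>transpose Q\<close> is the form in which the
  equivariance of Gram--Schmidt applies.\<close>

lemma matrix_mult_rows:
  "A ** Q = (\<chi> i. transpose Q *v (A $ i))" for A :: "real ^ 'n ^ 'k" and Q :: "real ^ 'n ^ 'n"
  by (simp add: vec_eq_iff matrix_matrix_mult_def matrix_vector_mult_def transpose_def mult.commute)

lemma orthogonal_transformation_matrix_mult_right:
  fixes Q :: "real ^ 'n ^ 'n"
  assumes "orthogonal_matrix Q"
  shows "orthogonal_transformation (\<lambda>A :: real ^ 'n ^ 'k. A ** Q)"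
  unfolding orthogonal_transformation
proof (intro conjI allI)
  show "linear (\<lambda>A. A ** Q)"
    by (rule linear_matrix_mult_right)
  fix A :: "real ^ 'n ^ 'k"
  \<comment> \<open>The matrix norm is the Euclidean norm of the vector of row norms, and
    \<open>transpose Q\<close> preserves each row norm.\<close>
  have "norm B = L2_set (\<lambda>i. norm (B $ i)) UNIV" for B :: "real ^ 'n ^ 'k"
    by (rule norm_vec_def)
  then show "norm (A ** Q) = norm A"
    using assms norm_orthogonal_matrix[of "transpose Q"] by (simp add: matrix_mult_rows)
qed

text \<open>As \<open>G\<close> is its own preimage, intersecting with \<open>G\<close> commutes
  with taking preimages under \<open>f\<close>, so the normalised restriction inherits the
  invariance.\<close>

lemma distr_uniform_measure:
  assumes [measurable]: "f \<in> measurable M M" and "G \<in> sets M"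
    and "distr M M f = M" and "f -` G \<inter> space M = G"
  shows "distr (uniform_measure M G) M f = uniform_measure M G"
proof (rule measure_eqI)
  note [measurable] = \<open>G \<in> sets M\<close>
  fix A assume "A \<in> sets (distr (uniform_measure M G) M f)"
  then have [measurable]: "A \<in> sets M" by simp
  have "emeasure M (G \<inter> (f -` A \<inter> space M)) = emeasure M (f -` (G \<inter> A) \<inter> space M)"
    using assms(4) by (intro arg_cong[where f = "emeasure M"]) auto
  also have "\<dots> = emeasure (distr M M f) (G \<inter> A)"
    by (rule emeasure_distr[symmetric]) measurable
  finally have "emeasure M (G \<inter> (f -` A \<inter> space M)) = emeasure M (G \<inter> A)"
    by (simp add: assms)
  then show "emeasure (distr (uniform_measure M G) M f) A = emeasure (uniform_measure M G) A"
    by (simp add: emeasure_distr)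
qed simp

lemma continuous_on_det: "continuous_on S (det :: real ^ 'n ^ 'n \<Rightarrow> real)"
  unfolding det_def by (intro continuous_intros)

lemma orthogonal_matrix_gram_schmidt:
  fixes A :: "real ^ 'm ^ 'm"
  assumes "det A \<noteq> 0" "distinct ks" "set ks = UNIV"
  shows "orthogonal_matrix (\<chi> i. gram_schmidt ks A i)"
  using assms orthonormal_gram_schmidt[of A ks]
  by (simp add: orthogonal_matrix_orthonormal_rows row_def orthogonal_def norm_eq_1)

text \<open>The measure lives on all matrices, hence the almost-everywhere form of orthogonality.
  Invariance is on the right because orthonormalising rows commutes with right multiplication, and
  replacing \<open>D\<close> by \<open>D ** Q\<close> is what makes the average symmetric.\<close>

lemma ex_invariant_prob_orthogonal_matrix:
  "\<exists>\<mu> :: (real ^ 'm ^ 'm) measure. prob_space \<mu> \<and> sets \<mu> = sets borel \<and>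
     (AE D in \<mu>. orthogonal_matrix D) \<and>
     (\<forall>Q. orthogonal_matrix Q \<longrightarrow> distr \<mu> borel (\<lambda>D. D ** Q) = \<mu>)"
proof -
  \<comment> \<open>Invertibility makes the orthonormalised rows an orthonormal basis. The ball
    makes the measure finite, and its radius exceeds the norm of the identity so that
    \<open>G\<close> is nonempty. Both conditions survive multiplication by an orthogonal
    matrix.\<close>
  define G where "G = {A :: real ^ 'm ^ 'm. det A \<noteq> 0} \<inter> ball 0 (norm (mat 1 :: real ^ 'm ^ 'm) + 1)"
  define U where "U = uniform_measure lborel G"
  have opn: "open G"
    unfolding G_def by (intro open_Int open_Collect_neq continuous_on_det continuous_on_const) auto
  then have [measurable]: "G \<in> sets borel" by simp
  have "mat 1 \<in> G" by (simp add: G_def)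
  then have "bounded G" "G \<noteq> {}" by (auto, simp add: G_def bounded_Int)
  note G = emeasure_lborel_open_bounded[OF opn this]
  interpret U: prob_space U
    unfolding U_def by (rule prob_space_uniform_measure[OF G])
  have [measurable_cong, simp]: "sets U = sets borel" by (simp add: U_def)
  obtain ks :: "'m list" where ks: "set ks = UNIV" "distinct ks"
    using finite_distinct_list[of "UNIV :: 'm set"] by auto
  define F where "F A = (\<chi> i. gram_schmidt ks A i)" for A :: "real ^ 'm ^ 'm"
  have [measurable]: "F \<in> borel_measurable borel"
  proof (rule borel_measurable_euclidean_space[THEN iffD2], rule ballI)
    fix b :: "real ^ 'm ^ 'm"
    note [measurable] = gram_schmidt_measurable
    show "(\<lambda>A. F A \<bullet> b) \<in> borel_measurable borel"
      unfolding F_def inner_vec_def[of "vec_lambda _"] vec_lambda_beta by measurable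
  qed
  have F: "F (A ** Q) = F A ** Q" if "orthogonal_matrix Q" for A Q
    using gram_schmidt_orthogonal_transformation[of "(*v) (transpose Q)" ks A] that
      orthogonal_transformation_matrix[of "(*v) (transpose Q)"]
    by (simp add: F_def matrix_mult_rows)
  have inv: "distr U borel (\<lambda>A. A ** Q) = U" if Q: "orthogonal_matrix Q" for Q
  proof -
    have nz: "det Q \<noteq> 0" using det_orthogonal_matrix[OF Q] by auto
    have norm: "norm (A ** Q) = norm A" for A :: "real ^ 'm ^ 'm"
      by (rule orthogonal_transformation_norm[OF orthogonal_transformation_matrix_mult_right[OF Q]])
    have *: "distr lborel borel (\<lambda>A :: real ^ 'm ^ 'm. A ** Q) = lborel"
      by (intro lborel_distr_orthogonal_transformation orthogonal_transformation_matrix_mult_right Q)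
    have "distr U lborel (\<lambda>A. A ** Q) = U"
      unfolding U_def using *
      by (intro distr_uniform_measure)
        (use \<open>G \<in> sets borel\<close> in \<open>auto simp: G_def det_mul nz norm cong: distr_cong\<close>)
    then show ?thesis by (simp cong: distr_cong)
  qed
  \<comment> \<open>By equivariance the factor \<open>Q\<close> moves inside \<open>F\<close>, where
    the invariance of \<open>U\<close> absorbs it.\<close>
  have "distr (distr U borel F) borel (\<lambda>D. D ** Q) = distr U borel F" if Q: "orthogonal_matrix Q" for Q
  proof -
    have "distr (distr U borel F) borel (\<lambda>D. D ** Q) = distr U borel (\<lambda>A. F (A ** Q))"
      by (simp add: distr_distr comp_def F[OF Q])
    also have "\<dots> = distr (distr U borel (\<lambda>A. A ** Q)) borel F"
      by (simp add: distr_distr comp_def)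
    finally show ?thesis by (simp add: inv[OF Q])
  qed
  moreover have "AE D in distr U borel F. orthogonal_matrix D"
  proof -
    \<comment> \<open>Moving an almost-everywhere statement through \<open>distr\<close> requires a
      Borel set; orthogonality is a finite system of equations between inner products of
      rows.\<close>
    have [measurable]: "Measurable.pred borel (orthogonal_matrix :: real ^ 'm ^ 'm \<Rightarrow> bool)"
    proof -
      have [measurable]: "(\<lambda>A :: real ^ 'm ^ 'm. A $ i) \<in> borel_measurable borel" for i
        by (intro borel_measurable_continuous_onI continuous_intros)
      have "Measurable.pred borel (\<lambda>A :: real ^ 'm ^ 'm. A $ i \<bullet> A $ j = c)" for i j c
        by measurable
      then show ?thesis
        unfolding orthogonal_matrix_orthonormal_rows row_def orthogonal_def vec_nth_inverse norm_eq_1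
        by (intro pred_intros_logic pred_intros_countable measurable_const UNIV_I) simp_all
    qed
    have "AE A in U. A \<in> G"
      unfolding U_def by (rule AE_uniform_measureI) auto
    then have "AE A in U. orthogonal_matrix (F A)"
      by eventually_elim (simp add: F_def G_def orthogonal_matrix_gram_schmidt ks)
    then show ?thesis by (subst AE_distr_iff) (auto simp: pred_def)
  qed
  ultimately show ?thesis
    by (intro exI[of _ "distr U borel F"]) (auto intro: U.prob_space_distr)
qed

section \<open>Rotation invariance of the noise\<close>

lemma borel_measurable_vec_lambda:
  fixes f :: "'a \<Rightarrow> 'm::finite \<Rightarrow> real"
  assumes "\<And>i. (\<lambda>x. f x i) \<in> borel_measurable M"
  shows "(\<lambda>x. \<chi> i. f x i) \<in> borel_measurable M"
proof (rule borel_measurable_euclidean_space[THEN iffD2], rule ballI)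
  fix b :: "real ^ 'm"
  note [measurable] = assms
  show "(\<lambda>x. (\<chi> i. f x i) \<bullet> b) \<in> borel_measurable M"
    unfolding inner_vec_def vec_lambda_beta by measurable
qed

text \<open>Independence yields a product measure on functions, whereas rotations act on vectors.
  The two Lebesgue measures are compared on open boxes, which determine
  \<open>lborel\<close>.\<close>

lemma distr_vec_lambda_lborel:
  "distr (Pi\<^sub>M UNIV (\<lambda>_. lborel)) borel vec_lambda = (lborel :: (real ^ 'm) measure)"
proof (rule lborel_eqI[symmetric])
  interpret finite_product_sigma_finite "\<lambda>_ :: 'm. lborel :: real measure" UNIV
    by standard auto
  have [measurable]: "(vec_lambda :: _ \<Rightarrow> real ^ 'm) \<in> borel_measurable (Pi\<^sub>M (UNIV :: 'm set) (\<lambda>_. lborel))"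
    using borel_measurable_vec_lambda[of "\<lambda>x. x" "Pi\<^sub>M (UNIV :: 'm set) (\<lambda>_. lborel)"] by simp
  fix l u :: "real ^ 'm"
  assume "\<And>b. b \<in> Basis \<Longrightarrow> l \<bullet> b \<le> u \<bullet> b"
  then have le: "l $ i \<le> u $ i" for i
    by (metis axis_in_Basis_iff cart_eq_inner_axis real_inner_1_right inner_real_def Basis_real_def singletonI)
  have Basis: "(Basis :: (real ^ 'm) set) = range (\<lambda>i. axis i 1)"
    by (auto simp: Basis_vec_def)
  have "vec_lambda -` box l u \<inter> space (Pi\<^sub>M UNIV (\<lambda>_. lborel)) = (\<Pi>\<^sub>E i\<in>UNIV. {l $ i<..<u $ i})"
    by (auto simp: mem_box_cart space_PiM PiE_def Pi_def)
  then have "emeasure (distr (Pi\<^sub>M UNIV (\<lambda>_. lborel)) borel vec_lambda) (box l u)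
      = (\<Prod>i\<in>UNIV. emeasure lborel {l $ i<..<u $ i})"
    by (simp add: emeasure_distr measure_times)
  also have "\<dots> = (\<Prod>i\<in>UNIV. ennreal ((u - l) $ i))"
    using le by simp
  also have "\<dots> = ennreal (\<Prod>i\<in>UNIV. (u - l) $ i)"
    using le by (intro prod_ennreal) simp
  also have "(\<Prod>i\<in>UNIV. (u - l) $ i) = (\<Prod>b\<in>Basis. (u - l) \<bullet> b)"
    unfolding Basis by (subst prod.reindex) (auto simp: inj_on_def axis_eq_axis cart_eq_inner_axis)
  finally show "emeasure (distr (Pi\<^sub>M UNIV (\<lambda>_. lborel)) borel vec_lambda) (box l u)
      = (\<Prod>b\<in>Basis. (u - l) \<bullet> b)" .
qed simp

text \<open>On a measurable rectangle the product density and the indicator both factor over the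
  coordinates, and rectangles determine the product measure.\<close>

lemma PiM_density:
  fixes f :: "'i \<Rightarrow> 'a \<Rightarrow> ennreal"
  assumes "finite I" and M: "\<And>i. sigma_finite_measure (M i)"
    and f[measurable]: "\<And>i. f i \<in> borel_measurable (M i)"
    and "\<And>i. sigma_finite_measure (density (M i) (f i))"
  shows "Pi\<^sub>M I (\<lambda>i. density (M i) (f i)) = density (Pi\<^sub>M I M) (\<lambda>x. \<Prod>i\<in>I. f i (x i))"
proof -
  interpret M: product_sigma_finite M using M by (rule product_sigma_finite.intro)
  interpret d: product_sigma_finite "\<lambda>i. density (M i) (f i)"
    using assms(4) by (rule product_sigma_finite.intro)
  show ?thesis
  proof (rule d.PiM_eqI[symmetric])
    show "sets (density (Pi\<^sub>M I M) (\<lambda>x. \<Prod>i\<in>I. f i (x i))) = sets (Pi\<^sub>M I (\<lambda>i. density (M i) (f i)))"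
      by (simp cong: sets_PiM_cong)
    fix A assume A: "\<And>i. i \<in> I \<Longrightarrow> A i \<in> sets (density (M i) (f i))"
    then have [measurable]: "\<And>i. i \<in> I \<Longrightarrow> A i \<in> sets (M i)" by simp
    have "emeasure (density (Pi\<^sub>M I M) (\<lambda>x. \<Prod>i\<in>I. f i (x i))) (Pi\<^sub>E I A)
        = (\<integral>\<^sup>+x. (\<Prod>i\<in>I. f i (x i)) * indicator (Pi\<^sub>E I A) x \<partial>Pi\<^sub>M I M)"
      using \<open>finite I\<close> by (intro emeasure_density sets_PiM_I_finite) auto
    also have "\<dots> = (\<integral>\<^sup>+x. (\<Prod>i\<in>I. f i (x i) * indicator (A i) (x i)) \<partial>Pi\<^sub>M I M)"
      using \<open>finite I\<close>
      by (intro nn_integral_cong) (auto simp: prod.distrib indicator_def space_PiM PiE_def Pi_def prod_zero_iff)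
    also have "\<dots> = (\<Prod>i\<in>I. \<integral>\<^sup>+x. f i x * indicator (A i) x \<partial>M i)"
      using \<open>finite I\<close> by (intro M.product_nn_integral_prod) auto
    also have "\<dots> = (\<Prod>i\<in>I. emeasure (density (M i) (f i)) (A i))"
      by (intro prod.cong refl emeasure_density[symmetric]) auto
    finally show "emeasure (density (Pi\<^sub>M I M) (\<lambda>x. \<Prod>i\<in>I. f i (x i))) (Pi\<^sub>E I A)
      = (\<Prod>i\<in>I. emeasure (density (M i) (f i)) (A i))" .
  qed fact
qed

lemma standard_normal_noise_measurable:
  assumes "standard_normal_noise M \<epsilon>"
  shows "(\<lambda>\<omega>. \<chi> i. \<epsilon> i \<omega>) \<in> borel_measurable M"
  using assms unfolding standard_normal_noise_def
  by (intro borel_measurable_vec_lambda) (auto dest!: spec distributed_measurable)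

lemma distr_standard_normal_noise:
  fixes \<epsilon> :: "'m::finite \<Rightarrow> 'w \<Rightarrow> real"
  assumes noise: "standard_normal_noise M \<epsilon>"
  shows "distr M borel (\<lambda>\<omega>. \<chi> i. \<epsilon> i \<omega>)
    = density lborel (\<lambda>x. \<Prod>i\<in>UNIV. ennreal (std_normal_density (x $ i)))"
proof -
  interpret prob_space M using noise by (simp add: standard_normal_noise_def)
  have d: "distributed M lborel (\<epsilon> i) std_normal_density" for i
    using noise by (simp add: standard_normal_noise_def)
  then have eps [measurable]: "\<epsilon> i \<in> borel_measurable M" for i
    using distributed_measurable by (metis measurable_lborel1)
  let ?g = "\<lambda>_ x. ennreal (std_normal_density x)"
  let ?L = "Pi\<^sub>M (UNIV :: 'm set) (\<lambda>_. lborel :: real measure)"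
  have [measurable]: "(vec_lambda :: _ \<Rightarrow> real ^ 'm) \<in> borel_measurable ?L"
    "(vec_lambda :: _ \<Rightarrow> real ^ 'm) \<in> borel_measurable (Pi\<^sub>M UNIV (\<lambda>_. borel))"
    using borel_measurable_vec_lambda[of "\<lambda>x. x" ?L]
      borel_measurable_vec_lambda[of "\<lambda>x. x" "Pi\<^sub>M (UNIV :: 'm set) (\<lambda>_. borel)"] by simp_all
  have [measurable]: "(\<lambda>\<omega> i. \<epsilon> i \<omega>) \<in> measurable M (Pi\<^sub>M UNIV (\<lambda>_. borel))"
    using measurable_restrict[of UNIV \<epsilon> M "\<lambda>_. borel", OF eps] by (simp add: restrict_UNIV)
  have "distr M (Pi\<^sub>M UNIV (\<lambda>_. borel)) (\<lambda>\<omega> i. \<epsilon> i \<omega>) = Pi\<^sub>M UNIV (\<lambda>i. distr M borel (\<epsilon> i))"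
    using noise indep_vars_iff_distr_eq_PiM[where I = UNIV and M' = "\<lambda>_. borel" and X = \<epsilon>]
    by (simp add: standard_normal_noise_def restrict_UNIV)
  also have "\<dots> = Pi\<^sub>M UNIV (\<lambda>i. density lborel (?g i))"
    using distributed_distr_eq_density[OF d] by (intro PiM_cong) (simp_all cong: distr_cong)
  also have "\<dots> = density ?L (\<lambda>x. \<Prod>i\<in>UNIV. ?g i (x i))"
    using prob_space_normal_density[of 1 0]
    by (intro PiM_density) (auto intro: lborel.sigma_finite_measure_axioms prob_space_imp_sigma_finite)
  finally have *: "distr M (Pi\<^sub>M UNIV (\<lambda>_. borel)) (\<lambda>\<omega> i. \<epsilon> i \<omega>) = density ?L (\<lambda>x. \<Prod>i\<in>UNIV. ?g i (x i))" .
  have "distr M borel (\<lambda>\<omega>. \<chi> i. \<epsilon> i \<omega>)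
      = distr (distr M (Pi\<^sub>M UNIV (\<lambda>_. borel)) (\<lambda>\<omega> i. \<epsilon> i \<omega>)) borel vec_lambda"
    by (subst distr_distr) (auto simp: comp_def)
  also have "\<dots> = density (distr ?L borel vec_lambda) (\<lambda>x. \<Prod>i\<in>UNIV. ?g i (x $ i))"
    unfolding * by (subst density_distr) auto
  finally show ?thesis by (simp add: distr_vec_lambda_lborel)
qed

lemma norm_vec_power2: "(norm x)\<^sup>2 = (\<Sum>i\<in>UNIV. (x $ i)\<^sup>2)" for x :: "real ^ 'n"
  by (simp only: power2_norm_eq_inner inner_vec_def) (simp add: power2_eq_square)

text \<open>The joint density depends on \<open>x\<close> only through \<open>norm x\<close>, and
  \<open>f\<close> preserves both the norm and Lebesgue measure.\<close>

lemma distr_standard_normal_noise_rotation: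
  fixes \<epsilon> :: "'m::finite \<Rightarrow> 'w \<Rightarrow> real"
  assumes noise: "standard_normal_noise M \<epsilon>" and f: "orthogonal_transformation f"
  defines "N \<equiv> distr M borel (\<lambda>\<omega>. \<chi> i. \<epsilon> i \<omega>)"
  shows "distr N borel f = N"
proof -
  define g where "g x = (\<Prod>i\<in>UNIV. ennreal (std_normal_density (x $ i)))" for x :: "real ^ 'm"
  have N: "N = density lborel g"
    unfolding N_def g_def by (rule distr_standard_normal_noise[OF noise])
  have g: "g x = ennreal ((1 / sqrt (2 * pi)) ^ CARD('m) * exp (- (norm x)\<^sup>2 / 2))" for x
  proof -
    have "(\<Sum>i\<in>UNIV. - (x $ i)\<^sup>2 / 2) = - (norm x)\<^sup>2 / 2"
      by (simp add: norm_vec_power2 sum_negf flip: sum_divide_distrib)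
    moreover have "(\<Prod>i\<in>UNIV. std_normal_density (x $ i))
        = (1 / sqrt (2 * pi)) ^ CARD('m) * exp (\<Sum>i\<in>UNIV. - (x $ i)\<^sup>2 / 2)"
      by (simp add: std_normal_density_def exp_sum prod_dividef power_one_over)
    ultimately show ?thesis by (simp add: g_def prod_ennreal)
  qed
  have [measurable]: "f \<in> borel_measurable borel"
    using f by (intro borel_measurable_continuous_onI linear_continuous_on linear_conv_bounded_linear[THEN iffD1])
      (simp add: orthogonal_transformation)
  have [measurable]: "g \<in> borel_measurable borel" unfolding g by measurable
  have "g (f x) = g x" for x by (simp add: g orthogonal_transformation_norm[OF f])
  then have "distr N borel f = density (distr lborel borel f) g"
    unfolding N by (subst density_distr) auto
  then show ?thesis by (simp add: N lborel_distr_orthogonal_transformation[OF f])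
qed

section \<open>Averaged estimators\<close>

text \<open>Jensen's inequality for the squared norm, by Cauchy--Schwarz against the constant 1; the
  right-hand side may be infinite.\<close>

lemma norm_integral_power2_le:
  fixes g :: "'a \<Rightarrow> 'b::{banach, second_countable_topology}"
  assumes "prob_space M" "integrable M g"
  shows "ennreal ((norm (\<integral>x. g x \<partial>M))\<^sup>2) \<le> (\<integral>\<^sup>+x. ennreal ((norm (g x))\<^sup>2) \<partial>M)"
proof -
  interpret prob_space M by fact
  have [measurable]: "g \<in> borel_measurable M" using assms(2) by simp
  have "ennreal ((norm (\<integral>x. g x \<partial>M))\<^sup>2) = (ennreal (norm (\<integral>x. g x \<partial>M)))\<^sup>2"
    by (simp add: ennreal_power)
  also have "\<dots> \<le> (\<integral>\<^sup>+x. ennreal (norm (g x)) \<partial>M)\<^sup>2"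
    by (intro power_mono integral_norm_bound_ennreal assms) simp
  also have "\<dots> \<le> (\<integral>\<^sup>+x. (ennreal (norm (g x)))\<^sup>2 \<partial>M) * (\<integral>\<^sup>+x. 1\<^sup>2 \<partial>M)"
    using Cauchy_Schwarz_nn_integral[of "\<lambda>x. norm (g x)" M "\<lambda>_. 1"] by simp
  finally show ?thesis by (simp add: ennreal_power emeasure_space_1)
qed

text \<open>The analytic core, free of any group: the uniform bounds first give joint integrability
  of \<open>f\<close>, Fubini then exchanges the two averages, and convexity yields the
  estimates.\<close>

lemma average_bias_variance:
  fixes f :: "'a \<times> 'b \<Rightarrow> 'c::{banach, second_countable_topology}"
  assumes \<mu>: "prob_space \<mu>" and N: "prob_space N"
    and f[measurable]: "f \<in> borel_measurable (\<mu> \<Otimes>\<^sub>M N)"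
    and bias: "AE D in \<mu>. norm ((\<integral>x. f (D, x) \<partial>N) - \<theta>) \<le> b"
    and var: "AE D in \<mu>. (\<integral>\<^sup>+x. ennreal ((norm (f (D, x) - (\<integral>y. f (D, y) \<partial>N)))\<^sup>2) \<partial>N) \<le> V"
    and V: "V < \<infinity>"
  shows "integrable N (\<lambda>x. \<integral>D. f (D, x) \<partial>\<mu>)" (is ?int)
    and "norm ((\<integral>x. \<integral>D. f (D, x) \<partial>\<mu> \<partial>N) - \<theta>) \<le> b" (is ?bias)
    and "(\<integral>\<^sup>+x. ennreal ((norm ((\<integral>D. f (D, x) \<partial>\<mu>) - (\<integral>y. \<integral>D. f (D, y) \<partial>\<mu> \<partial>N)))\<^sup>2) \<partial>N) \<le> V" (is ?var)
proof -
  interpret \<mu>: prob_space \<mu> by fact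
  interpret N: prob_space N by fact
  interpret pair_sigma_finite \<mu> N ..
  define h where "h D = (\<integral>x. f (D, x) \<partial>N)" for D
  have [measurable]: "h \<in> borel_measurable \<mu>"
    unfolding h_def by measurable
  have "(\<integral>\<^sup>+z. ennreal (norm (f z)) \<partial>(\<mu> \<Otimes>\<^sub>M N)) = (\<integral>\<^sup>+D. \<integral>\<^sup>+x. ennreal (norm (f (D, x))) \<partial>N \<partial>\<mu>)"
    by (rule N.nn_integral_fst[symmetric]) measurable
  \<comment> \<open>The centre \<open>h D\<close> has norm at most \<open>b + norm \<theta>\<close>,
    and the deviation from it is at most its square plus 1. The variance bound thus controls the
    first absolute moment for almost every \<open>D\<close>.\<close>
  also have "\<dots> \<le> (\<integral>\<^sup>+D. V + ennreal (1 + b + norm \<theta>) \<partial>\<mu>)"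
  proof (rule nn_integral_mono_AE, use bias var AE_space in eventually_elim)
    fix D assume D: "norm ((\<integral>x. f (D, x) \<partial>N) - \<theta>) \<le> b" "D \<in> space \<mu>"
      "(\<integral>\<^sup>+x. ennreal ((norm (f (D, x) - (\<integral>y. f (D, y) \<partial>N)))\<^sup>2) \<partial>N) \<le> V"
    then have [measurable]: "(\<lambda>x. f (D, x)) \<in> borel_measurable N" by measurable
    have h: "norm (h D) \<le> b + norm \<theta>"
      using D(1) norm_triangle_sub[of "h D" \<theta>] by (simp add: h_def)
    have "norm (f (D, x)) \<le> (norm (f (D, x) - h D))\<^sup>2 + (1 + b + norm \<theta>)" for x
    proof -
      have "t \<le> t\<^sup>2 + 1" for t :: real
        using zero_le_power2[of "t - 1/2"] by (simp add: power2_eq_square algebra_simps)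
      from this[of "norm (f (D, x) - h D)"] show ?thesis
        using h norm_triangle_sub[of "f (D, x)" "h D"] by linarith
    qed
    moreover have "0 \<le> 1 + b + norm \<theta>"
      using h norm_ge_zero[of "h D"] by linarith
    ultimately have "(\<integral>\<^sup>+x. ennreal (norm (f (D, x))) \<partial>N)
        \<le> (\<integral>\<^sup>+x. ennreal ((norm (f (D, x) - h D))\<^sup>2) + ennreal (1 + b + norm \<theta>) \<partial>N)"
      by (intro nn_integral_mono) (simp add: ennreal_leI flip: ennreal_plus)
    also have "\<dots> = (\<integral>\<^sup>+x. ennreal ((norm (f (D, x) - h D))\<^sup>2) \<partial>N) + ennreal (1 + b + norm \<theta>)"
      by (subst nn_integral_add) (auto simp: N.emeasure_space_1)
    finally show "(\<integral>\<^sup>+x. ennreal (norm (f (D, x))) \<partial>N) \<le> V + ennreal (1 + b + norm \<theta>)"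
      using D(3) by (auto simp: h_def intro: order_trans add_right_mono)
  qed
  also have "\<dots> < \<infinity>"
    using V by (simp add: \<mu>.emeasure_space_1)
  finally have int: "integrable (\<mu> \<Otimes>\<^sub>M N) f"
    by (intro integrableI_bounded) auto
  then have int': "integrable (\<mu> \<Otimes>\<^sub>M N) (\<lambda>(D, x). f (D, x))" by simp
  show ?int by (rule integrable_snd[OF int'])
  have h: "integrable \<mu> h"
    unfolding h_def by (rule integrable_fst[OF int'])
  have S: "(\<integral>x. \<integral>D. f (D, x) \<partial>\<mu> \<partial>N) = (\<integral>D. h D \<partial>\<mu>)"
    unfolding h_def by (rule Fubini_integral[OF int'])
  have "norm ((\<integral>D. h D \<partial>\<mu>) - \<theta>) = norm (\<integral>D. h D - \<theta> \<partial>\<mu>)"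
    using h by (simp add: \<mu>.prob_space)
  also have "\<dots> \<le> (\<integral>D. norm (h D - \<theta>) \<partial>\<mu>)" by (rule integral_norm_bound)
  also have "\<dots> \<le> b"
    using h bias by (intro \<mu>.integral_le_const) (auto simp flip: h_def)
  finally show ?bias by (simp add: S)
  \<comment> \<open>Sections in \<open>D\<close> are integrable for almost every \<open>x\<close>.
    For these, Jensen applies to \<open>f (D, x) - h D\<close>, whose integral over \<open>D\<close>
    is the centred error of the average.\<close>
  have "AE x in N. integrable \<mu> (\<lambda>D. f (D, x))" by (rule AE_integrable_snd[OF int'])
  then have "AE x in N. ennreal ((norm ((\<integral>D. f (D, x) \<partial>\<mu>) - (\<integral>D. h D \<partial>\<mu>)))\<^sup>2)
      \<le> (\<integral>\<^sup>+D. ennreal ((norm (f (D, x) - h D))\<^sup>2) \<partial>\<mu>)"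
  proof eventually_elim
    fix x assume "integrable \<mu> (\<lambda>D. f (D, x))"
    then show "ennreal ((norm ((\<integral>D. f (D, x) \<partial>\<mu>) - (\<integral>D. h D \<partial>\<mu>)))\<^sup>2)
      \<le> (\<integral>\<^sup>+D. ennreal ((norm (f (D, x) - h D))\<^sup>2) \<partial>\<mu>)"
      using norm_integral_power2_le[OF \<mu>, of "\<lambda>D. f (D, x) - h D"] h by simp
  qed
  then have "(\<integral>\<^sup>+x. ennreal ((norm ((\<integral>D. f (D, x) \<partial>\<mu>) - (\<integral>D. h D \<partial>\<mu>)))\<^sup>2) \<partial>N)
      \<le> (\<integral>\<^sup>+x. \<integral>\<^sup>+D. ennreal ((norm (f (D, x) - h D))\<^sup>2) \<partial>\<mu> \<partial>N)"
    by (rule nn_integral_mono_AE)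
  also have "\<dots> = (\<integral>\<^sup>+D. \<integral>\<^sup>+x. ennreal ((norm (f (D, x) - h D))\<^sup>2) \<partial>N \<partial>\<mu>)"
    by (rule Fubini') measurable
  also have "\<dots> \<le> (\<integral>\<^sup>+D. V \<partial>\<mu>)"
    using var by (intro nn_integral_mono_AE) (simp add: h_def)
  finally show ?var by (simp add: S \<mu>.emeasure_space_1)
qed

text \<open>Spherical symmetry is phrased with \<open>matrix_inv\<close>, a choice among inverses,
  while the average uses \<open>transpose\<close>; uniqueness of the inverse reconciles
  them.\<close>

lemma matrix_inv_orthogonal_matrix:
  fixes Q :: "real ^ 'n ^ 'n"
  assumes "orthogonal_matrix Q"
  shows "matrix_inv Q = transpose Q"
proof -
  have Q: "Q ** transpose Q = mat 1" "transpose Q ** Q = mat 1"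
    using assms by (auto simp: orthogonal_matrix_def)
  then have "Q ** matrix_inv Q = mat 1"
    unfolding matrix_inv_def by (rule_tac someI2) blast+
  then have "transpose Q ** (Q ** matrix_inv Q) = transpose Q" by simp
  then show ?thesis by (simp add: matrix_mul_assoc Q)
qed

lemma transpose_mult_orthogonal_matrix:
  fixes Q :: "real ^ 'n ^ 'n"
  assumes "orthogonal_matrix Q"
  shows "transpose Q *v (Q *v x) = x" "Q *v (transpose Q *v x) = x"
  using assms by (simp_all add: matrix_vector_mul_assoc orthogonal_matrix_def del: vector_transpose_matrix transpose_matrix_vector)

lemma matrix_vector_mult_measurable [measurable (raw)]:
  fixes f :: "'a \<Rightarrow> real ^ 'n ^ 'm" and g :: "'a \<Rightarrow> real ^ 'n"
  assumes "f \<in> borel_measurable M" "g \<in> borel_measurable M"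
  shows "(\<lambda>x. f x *v g x) \<in> borel_measurable M"
  using assms
  by (rule borel_measurable_continuous_Pair) (auto simp: matrix_vector_mult_def intro!: continuous_intros)

lemma transpose_measurable [measurable (raw)]:
  fixes f :: "'a \<Rightarrow> real ^ 'n ^ 'm"
  assumes "f \<in> borel_measurable M"
  shows "(\<lambda>x. transpose (f x)) \<in> borel_measurable M"
  using assms
  by (rule borel_measurable_continuous_on[rotated]) (auto simp: transpose_def intro!: continuous_intros)

text \<open>\<open>transpose\<close> agrees with the inverse on orthogonal matrices and is
  continuous, hence measurable, on all matrices. Where the integrand is not integrable, the value is
  0.\<close>

definition average :: "(real ^ 'm ^ 'm) measure \<Rightarrow> (real ^ 'm \<Rightarrow> real ^ 'm) \<Rightarrow> real ^ 'm \<Rightarrow> real ^ 'm" where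
  "average \<mu> T x = (\<integral>D. transpose D *v T (D *v x) \<partial>\<mu>)"

lemma spherically_symmetric_average:
  fixes T :: "real ^ 'm \<Rightarrow> real ^ 'm"
  assumes [measurable]: "T \<in> borel_measurable borel"
    and [measurable_cong]: "sets \<mu> = sets borel"
    and inv: "\<And>Q. orthogonal_matrix Q \<Longrightarrow> distr \<mu> borel (\<lambda>D. D ** Q) = \<mu>"
  shows "spherically_symmetric (average \<mu> T)"
  unfolding spherically_symmetric_def
proof (intro allI impI)
  fix x :: "real ^ 'm" and Q :: "real ^ 'm ^ 'm"
  assume Q: "orthogonal_matrix Q"
  note tr = transpose_mult_orthogonal_matrix[OF Q]
  \<comment> \<open>Symmetry is claimed at every \<open>x\<close>, including those where the
    integrand is not integrable. Since \<open>Q\<close> has the linear inverse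
    \<open>transpose Q\<close>, it passes through the integral there too, both sides being
    0.\<close>
  have "Q *v average \<mu> T x = (\<integral>D. Q *v (transpose D *v T (D *v x)) \<partial>\<mu>)"
    unfolding average_def using tr
    by (intro integral_bounded_linear'[symmetric, where T' = "(*v) (transpose Q)"])
      (auto simp del: vector_transpose_matrix transpose_matrix_vector)
  \<comment> \<open>Invariance allows \<open>D ** Q\<close> in place of \<open>D\<close>; the outer
    \<open>Q\<close> then cancels against the transpose, and \<open>Q\<close> remains only in the
    argument of \<open>T\<close>.\<close>
  also have "\<dots> = (\<integral>D. Q *v (transpose D *v T (D *v x)) \<partial>distr \<mu> borel (\<lambda>D. D ** Q))"
    by (simp only: inv[OF Q])
  also have "\<dots> = (\<integral>D. Q *v (transpose (D ** Q) *v T ((D ** Q) *v x)) \<partial>\<mu>)"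
    by (rule integral_distr) measurable
  also have "\<dots> = (\<integral>D. transpose D *v T (D *v (Q *v x)) \<partial>\<mu>)"
    using tr by (simp add: matrix_transpose_mul matrix_vector_mul_assoc[symmetric]
      del: vector_transpose_matrix transpose_matrix_vector)
  also have "\<dots> = average \<mu> T (Q *v x)"
    by (simp add: average_def)
  finally show "average \<mu> T x = matrix_inv Q *v average \<mu> T (Q *v x)"
    by (metis matrix_inv_orthogonal_matrix[OF Q] tr(1))
qed

lemma average_measurable:
  fixes T :: "real ^ 'm \<Rightarrow> real ^ 'm"
  assumes [measurable]: "T \<in> borel_measurable borel"
    and "prob_space \<mu>" and [measurable_cong]: "sets \<mu> = sets borel"
  shows "average \<mu> T \<in> borel_measurable borel"
proof -
  interpret prob_space \<mu> by fact
  show ?thesis unfolding average_def by measurable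
qed

text \<open>\<open>N\<close> stands for the noise law and \<open>c\<close> for its scale;
  \<open>m\<close> and \<open>v\<close> are the mean and the total variance. Invariance of
  \<open>N\<close> turns the rotated estimator at \<theta> into a rotation of \<open>T\<close>
  observed at \<open>D *v \<theta>\<close>, where the assumed bounds apply.\<close>

lemma average_bias_variance_orthogonal:
  fixes T :: "real ^ 'm \<Rightarrow> real ^ 'm" and c :: real and \<theta> :: "real ^ 'm"
  assumes T[measurable]: "T \<in> borel_measurable borel"
    and \<mu>: "prob_space \<mu>" and [measurable_cong]: "sets \<mu> = sets borel"
    and orth: "AE D in \<mu>. orthogonal_matrix D"
    and N: "prob_space N" and [measurable_cong]: "sets N = sets borel"
    and inv: "\<And>Q. orthogonal_matrix Q \<Longrightarrow> distr N borel ((*v) Q) = N"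
  defines "m \<equiv> \<lambda>S \<theta>. \<integral>x. S (\<theta> + c *\<^sub>R x) \<partial>N"
  defines "v \<equiv> \<lambda>S \<theta>. \<integral>\<^sup>+x. ennreal ((norm (S (\<theta> + c *\<^sub>R x) - m S \<theta>))\<^sup>2) \<partial>N"
  assumes bias: "\<And>Q. orthogonal_matrix Q \<Longrightarrow> norm (m T (Q *v \<theta>) - Q *v \<theta>) \<le> b"
    and var: "\<And>Q. orthogonal_matrix Q \<Longrightarrow> v T (Q *v \<theta>) \<le> V"
    and V: "V < \<infinity>"
  shows "integrable N (\<lambda>x. average \<mu> T (\<theta> + c *\<^sub>R x))"
    and "norm (m (average \<mu> T) \<theta> - \<theta>) \<le> b"
    and "v (average \<mu> T) \<theta> \<le> V"
proof -
  define f where "f z = transpose (fst z) *v T (fst z *v (\<theta> + c *\<^sub>R snd z))" for z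
  have [measurable]: "f \<in> borel_measurable (\<mu> \<Otimes>\<^sub>M N)"
    unfolding f_def by measurable
  have f: "f (D, x) = transpose D *v T (D *v \<theta> + c *\<^sub>R (D *v x))" for D x
    by (simp add: f_def matrix_vector_right_distrib matrix_vector_mult_scaleR)
  have mean: "(\<integral>x. f (D, x) \<partial>N) = transpose D *v m T (D *v \<theta>)" if D: "orthogonal_matrix D" for D
  proof -
    \<comment> \<open>Invariance of \<open>N\<close> replaces \<open>D *v x\<close> by
      \<open>x\<close>; the outer \<open>transpose D\<close> then leaves the integral, being
      invertible.\<close>
    have "(\<integral>x. f (D, x) \<partial>N) = (\<integral>x. transpose D *v T (D *v \<theta> + c *\<^sub>R x) \<partial>distr N borel ((*v) D))"
      unfolding f by (rule integral_distr[symmetric]) measurable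
    also have "\<dots> = (\<integral>x. transpose D *v T (D *v \<theta> + c *\<^sub>R x) \<partial>N)"
      by (simp only: inv[OF D])
    also have "\<dots> = transpose D *v m T (D *v \<theta>)"
      unfolding m_def using transpose_mult_orthogonal_matrix[OF D]
      by (intro integral_bounded_linear'[where T' = "(*v) D"])
        (auto simp del: vector_transpose_matrix transpose_matrix_vector)
    finally show ?thesis .
  qed
  have nt: "norm (transpose D *v x) = norm x" if "orthogonal_matrix D" for D :: "real ^ 'm ^ 'm" and x
    using that by (intro norm_orthogonal_matrix) simp
  have bias': "norm ((\<integral>x. f (D, x) \<partial>N) - \<theta>) \<le> b" if D: "orthogonal_matrix D" for D
  proof -
    have "(\<integral>x. f (D, x) \<partial>N) - \<theta> = transpose D *v (m T (D *v \<theta>) - D *v \<theta>)"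
      unfolding mean[OF D] matrix_vector_mult_diff_distrib transpose_mult_orthogonal_matrix[OF D] ..
    then show ?thesis using bias[OF D] by (simp only: nt[OF D])
  qed
  have var': "(\<integral>\<^sup>+x. ennreal ((norm (f (D, x) - (\<integral>y. f (D, y) \<partial>N)))\<^sup>2) \<partial>N) \<le> V"
    if D: "orthogonal_matrix D" for D
  proof -
    have "(\<integral>\<^sup>+x. ennreal ((norm (f (D, x) - (\<integral>y. f (D, y) \<partial>N)))\<^sup>2) \<partial>N)
        = (\<integral>\<^sup>+x. ennreal ((norm (T (D *v \<theta> + c *\<^sub>R (D *v x)) - m T (D *v \<theta>)))\<^sup>2) \<partial>N)"
      unfolding mean[OF D] unfolding f by (simp only: nt[OF D] flip: matrix_vector_mult_diff_distrib)
    also have "\<dots> = (\<integral>\<^sup>+x. ennreal ((norm (T (D *v \<theta> + c *\<^sub>R x) - m T (D *v \<theta>)))\<^sup>2) \<partial>distr N borel ((*v) D))"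
      by (rule nn_integral_distr[symmetric]) measurable
    also have "\<dots> = v T (D *v \<theta>)"
      by (simp only: inv[OF D] v_def)
    finally show ?thesis using var[OF D] by simp
  qed
  have av: "average \<mu> T (\<theta> + c *\<^sub>R x) = (\<integral>D. f (D, x) \<partial>\<mu>)" for x
    by (simp add: average_def f_def)
  have *: "AE D in \<mu>. norm ((\<integral>x. f (D, x) \<partial>N) - \<theta>) \<le> b"
    "AE D in \<mu>. (\<integral>\<^sup>+x. ennreal ((norm (f (D, x) - (\<integral>y. f (D, y) \<partial>N)))\<^sup>2) \<partial>N) \<le> V"
    by (rule AE_mp[OF orth], simp add: bias' var')+
  note * = average_bias_variance[OF \<mu> N _ * V]
  show "integrable N (\<lambda>x. average \<mu> T (\<theta> + c *\<^sub>R x))"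
    unfolding av by (rule *) measurable
  show "norm (m (average \<mu> T) \<theta> - \<theta>) \<le> b"
    unfolding av m_def by (rule *) measurable
  show "v (average \<mu> T) \<theta> \<le> V"
    unfolding av m_def v_def by (rule *) measurable
qed

section \<open>Transfer to the Gaussian sequence model\<close>

lemma Theta_orthogonal_matrix: "orthogonal_matrix Q \<Longrightarrow> Q *v \<theta> \<in> Theta \<beta> R \<longleftrightarrow> \<theta> \<in> Theta \<beta> R"
  by (simp add: Theta_def norm_orthogonal_matrix)

text \<open>Rotations need not preserve single coordinate variances, but by Pythagoras their sum is
  the expected squared norm of the centred error, on which rotations act isometrically.\<close>

lemma sum_Var_eq:
  fixes T :: "real ^ 'm \<Rightarrow> real ^ 'm"
  assumes [measurable]: "\<And>i. (\<lambda>\<omega>. T (observation n \<epsilon> \<theta> \<omega>) $ i) \<in> borel_measurable M"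
  shows "(\<Sum>i\<in>UNIV. Var M \<epsilon> n \<theta> T i)
    = (\<integral>\<^sup>+\<omega>. ennreal ((norm (T (observation n \<epsilon> \<theta> \<omega>) - mean M \<epsilon> n \<theta> T))\<^sup>2) \<partial>M)"
  unfolding Var_def norm_vec_power2 by (subst nn_integral_sum[symmetric]) (auto simp: sum_ennreal)

theorem proposition5p4:
  fixes M :: "'w measure" and \<epsilon> :: "'m::finite \<Rightarrow> 'w \<Rightarrow> real"
    and n R :: real and \<beta> :: nat
    and T :: "real ^ 'm \<Rightarrow> real ^ 'm"
  assumes "standard_normal_noise M \<epsilon>"
    and "n > 0" and "R > 0" and "\<beta> \<ge> 1"
    and "estimator M \<epsilon> n (Theta \<beta> R) T"
  shows "\<exists>S :: real ^ 'm \<Rightarrow> real ^ 'm.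
           estimator M \<epsilon> n (Theta \<beta> R) S \<and> spherically_symmetric S \<and>
           (SUP \<theta>\<in>Theta \<beta> R. ennreal ((norm (mean M \<epsilon> n \<theta> S - \<theta>))\<^sup>2))
             \<le> (SUP \<theta>\<in>Theta \<beta> R. ennreal ((norm (mean M \<epsilon> n \<theta> T - \<theta>))\<^sup>2)) \<and>
           (SUP \<theta>\<in>Theta \<beta> R. \<Sum>i\<in>UNIV. Var M \<epsilon> n \<theta> S i)
             \<le> (SUP \<theta>\<in>Theta \<beta> R. \<Sum>i\<in>UNIV. Var M \<epsilon> n \<theta> T i)"
proof -
  interpret M: prob_space M using assms(1) by (simp add: standard_normal_noise_def)
  let ?bias = "\<lambda>T. SUP \<theta>\<in>Theta \<beta> R. ennreal ((norm (mean M \<epsilon> n \<theta> T - \<theta>))\<^sup>2)"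
  let ?var = "\<lambda>T. SUP \<theta>\<in>Theta \<beta> R. \<Sum>i\<in>UNIV. Var M \<epsilon> n \<theta> T i"
  define Y where "Y \<omega> = (\<chi> i. \<epsilon> i \<omega>)" for \<omega>
  have [measurable]: "Y \<in> borel_measurable M"
    unfolding Y_def by (rule standard_normal_noise_measurable[OF assms(1)])
  define c where "c = 1 / sqrt n"
  have obs: "observation n \<epsilon> \<theta> \<omega> = \<theta> + c *\<^sub>R Y \<omega>" for \<theta> \<omega>
    by (simp add: observation_def Y_def c_def vec_eq_iff)
  have T[measurable]: "T \<in> borel_measurable borel"
    using assms(5) by (simp add: estimator_def)
  consider "?bias T = \<infinity>" | "?var T = \<infinity>" | "?bias T < \<infinity>" "?var T < \<infinity>"
    by (auto simp: less_top[symmetric])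
  then show ?thesis
  proof cases
    case 1
    show ?thesis
    proof (intro exI[of _ "\<lambda>_. 0"] conjI)
      show "?var (\<lambda>_. 0) \<le> ?var T"
        by (intro SUP_least) (simp add: Var_def mean_def)
      show "?bias (\<lambda>_. 0) \<le> ?bias T"
        unfolding 1 by simp
    qed (simp_all add: estimator_def spherically_symmetric_def)
  next
    case 2
    have d: "distributed M lborel (\<epsilon> i) std_normal_density" for i
      using assms(1) by (simp add: standard_normal_noise_def)
    \<comment> \<open>The noise is centred, so the identity estimator is integrable and
      unbiased.\<close>
    have eps: "integrable M (\<epsilon> i)" "(\<integral>\<omega>. \<epsilon> i \<omega> \<partial>M) = 0" for i
      using distributed_integrable[OF d, of "\<lambda>x. x"] integrable_std_normal_moment[of 1]
        M.standard_normal_distributed_expectation[OF d] by simp_all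
    have "Y = (\<lambda>\<omega>. \<Sum>i\<in>UNIV. \<epsilon> i \<omega> *\<^sub>R axis i 1)"
      by (rule ext) (simp add: Y_def vec_eq_iff axis_def if_distrib cong: if_cong)
    then have Y: "integrable M Y" "(\<integral>\<omega>. Y \<omega> \<partial>M) = 0"
      using eps by (simp_all add: Bochner_Integration.integral_sum)
    show ?thesis
    proof (intro exI[of _ "\<lambda>x. x"] conjI)
      show "?bias (\<lambda>x. x) \<le> ?bias T"
        by (intro SUP_least) (simp add: mean_def obs Y M.prob_space)
      show "spherically_symmetric (\<lambda>x. x)"
        by (simp add: spherically_symmetric_def matrix_inv_orthogonal_matrix transpose_mult_orthogonal_matrix
          del: vector_transpose_matrix transpose_matrix_vector)
      show "?var (\<lambda>x. x) \<le> ?var T"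
        unfolding 2 by simp
    qed (simp add: estimator_def obs Y)
  next
    case 3
    define N where "N = distr M borel Y"
    interpret N: prob_space N unfolding N_def by (rule M.prob_space_distr) simp
    have setsN [measurable_cong]: "sets N = sets borel" by (simp add: N_def)
    have inv: "distr N borel ((*v) Q) = N" if "orthogonal_matrix Q" for Q
      unfolding N_def Y_def using that orthogonal_transformation_matrix[of "(*v) Q"]
      by (intro distr_standard_normal_noise_rotation[OF assms(1)]) simp
    obtain \<mu> :: "(real ^ 'm ^ 'm) measure" where \<mu>: "prob_space \<mu>" "sets \<mu> = sets borel"
        "AE D in \<mu>. orthogonal_matrix D"
        "\<And>Q. orthogonal_matrix Q \<Longrightarrow> distr \<mu> borel (\<lambda>D. D ** Q) = \<mu>"
      using ex_invariant_prob_orthogonal_matrix by metis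
    define S where "S = average \<mu> T"
    have S[measurable]: "S \<in> borel_measurable borel"
      unfolding S_def by (rule average_measurable[OF T \<mu>(1,2)])
    \<comment> \<open>For a Borel estimator these quantities depend on the noise only through its
      law \<open>N\<close>; the translation serves both \<open>T\<close> and
      \<open>S\<close>.\<close>
    have mean: "mean M \<epsilon> n \<theta> U = (\<integral>x. U (\<theta> + c *\<^sub>R x) \<partial>N)"
      and var: "(\<Sum>i\<in>UNIV. Var M \<epsilon> n \<theta> U i)
        = (\<integral>\<^sup>+x. ennreal ((norm (U (\<theta> + c *\<^sub>R x) - (\<integral>x. U (\<theta> + c *\<^sub>R x) \<partial>N)))\<^sup>2) \<partial>N)"
      and int: "integrable N (\<lambda>x. U (\<theta> + c *\<^sub>R x)) \<longleftrightarrow> integrable M (\<lambda>\<omega>. U (observation n \<epsilon> \<theta> \<omega>))"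
      if [measurable]: "U \<in> borel_measurable borel" for U :: "real ^ 'm \<Rightarrow> real ^ 'm" and \<theta>
    proof -
      show mean: "mean M \<epsilon> n \<theta> U = (\<integral>x. U (\<theta> + c *\<^sub>R x) \<partial>N)"
        unfolding mean_def obs N_def by (rule integral_distr[symmetric]) measurable
      show "integrable N (\<lambda>x. U (\<theta> + c *\<^sub>R x)) \<longleftrightarrow> integrable M (\<lambda>\<omega>. U (observation n \<epsilon> \<theta> \<omega>))"
        unfolding obs N_def by (rule integrable_distr_eq) measurable
      have "(\<Sum>i\<in>UNIV. Var M \<epsilon> n \<theta> U i)
          = (\<integral>\<^sup>+\<omega>. ennreal ((norm (U (observation n \<epsilon> \<theta> \<omega>) - mean M \<epsilon> n \<theta> U))\<^sup>2) \<partial>M)"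
        by (rule sum_Var_eq) (unfold obs, rule measurable_compose[OF _ borel_measurable_nth], measurable)
      also have "\<dots> = (\<integral>\<^sup>+x. ennreal ((norm (U (\<theta> + c *\<^sub>R x) - mean M \<epsilon> n \<theta> U))\<^sup>2) \<partial>N)"
        unfolding obs N_def by (rule nn_integral_distr[symmetric]) measurable
      finally show "(\<Sum>i\<in>UNIV. Var M \<epsilon> n \<theta> U i)
        = (\<integral>\<^sup>+x. ennreal ((norm (U (\<theta> + c *\<^sub>R x) - (\<integral>x. U (\<theta> + c *\<^sub>R x) \<partial>N)))\<^sup>2) \<partial>N)"
        by (simp only: mean)
    qed
    \<comment> \<open>The averaging lemma bounds the norm of the bias by a real number. The supremum
      is finite in this case, so \<open>enn2real\<close> loses nothing and \<open>b\<close> squared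
      recovers it.\<close>
    define b where "b = sqrt (enn2real (?bias T))"
    have bias_le: "norm (mean M \<epsilon> n \<theta> T - \<theta>) \<le> b" if "\<theta> \<in> Theta \<beta> R" for \<theta>
    proof -
      have "ennreal ((norm (mean M \<epsilon> n \<theta> T - \<theta>))\<^sup>2) \<le> ?bias T"
        using that by (rule SUP_upper)
      then have "(norm (mean M \<epsilon> n \<theta> T - \<theta>))\<^sup>2 \<le> enn2real (?bias T)"
        using 3(1) enn2real_mono[of "ennreal ((norm (mean M \<epsilon> n \<theta> T - \<theta>))\<^sup>2)"] by simp
      then show ?thesis unfolding b_def by (rule real_le_rsqrt)
    qed
    have b2: "ennreal (b\<^sup>2) = ?bias T"
      using 3(1) by (simp add: b_def)
    have main: "integrable M (\<lambda>\<omega>. S (observation n \<epsilon> \<theta> \<omega>))"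
      "norm (mean M \<epsilon> n \<theta> S - \<theta>) \<le> b" "(\<Sum>i\<in>UNIV. Var M \<epsilon> n \<theta> S i) \<le> ?var T"
      if \<theta>: "\<theta> \<in> Theta \<beta> R" for \<theta>
    proof -
      \<comment> \<open>The parameter set is a ball about 0, so \<open>Q *v \<theta>\<close> stays
        inside it and the suprema of \<open>T\<close> apply at the rotated parameter.\<close>
      have "norm ((\<integral>x. T (Q *v \<theta> + c *\<^sub>R x) \<partial>N) - Q *v \<theta>) \<le> b"
        "(\<integral>\<^sup>+x. ennreal ((norm (T (Q *v \<theta> + c *\<^sub>R x) - (\<integral>x. T (Q *v \<theta> + c *\<^sub>R x) \<partial>N)))\<^sup>2) \<partial>N) \<le> ?var T"
        if "orthogonal_matrix Q" for Q
      proof -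
        have *: "Q *v \<theta> \<in> Theta \<beta> R" using \<theta> that by (simp add: Theta_orthogonal_matrix)
        show "norm ((\<integral>x. T (Q *v \<theta> + c *\<^sub>R x) \<partial>N) - Q *v \<theta>) \<le> b"
          using bias_le[OF *] by (simp only: mean[OF T])
        show "(\<integral>\<^sup>+x. ennreal ((norm (T (Q *v \<theta> + c *\<^sub>R x) - (\<integral>x. T (Q *v \<theta> + c *\<^sub>R x) \<partial>N)))\<^sup>2) \<partial>N) \<le> ?var T"
          unfolding var[OF T, symmetric] using * by (rule SUP_upper)
      qed
      note * = average_bias_variance_orthogonal[OF T \<mu>(1-3) N.prob_space_axioms setsN inv this 3(2), folded S_def]
      show "integrable M (\<lambda>\<omega>. S (observation n \<epsilon> \<theta> \<omega>))"
        using *(1) by (simp only: int[OF S])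
      show "norm (mean M \<epsilon> n \<theta> S - \<theta>) \<le> b"
        using *(2) by (simp only: mean[OF S])
      show "(\<Sum>i\<in>UNIV. Var M \<epsilon> n \<theta> S i) \<le> ?var T"
        using *(3) by (simp only: var[OF S])
    qed
    show ?thesis
    proof (intro exI[of _ S] conjI)
      show "estimator M \<epsilon> n (Theta \<beta> R) S"
        using S main(1) by (simp add: estimator_def)
      show "spherically_symmetric S"
        unfolding S_def by (rule spherically_symmetric_average[OF T \<mu>(2,4)])
      show "?bias S \<le> ?bias T"
        unfolding b2[symmetric] using main(2) by (intro SUP_least ennreal_leI power_mono) auto
      show "?var S \<le> ?var T"
        using main(3) by (rule SUP_least)
    qed
  qed
qed

end
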